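(* Let $\mathcal{H}$ be a universal RKHS with kernel $k$ on a compact metric space $\mathcal{Z}$. Let $P$ and $Q$ be probability distributions on $\mathcal{Z}$ with densities $p>0$ and $q$, and assume $w_0=q/p\in\mathcal{H}$. For $w\in\mathcal{H}$ define $$\Phi(w)=\int k(\cdot,x)w(x)\,P(dx)-\int k(\cdot,y)\,Q(dy)\in\mathcal{H},$$ $$L_{\mathrm{KMM}}(w)=\frac12\|\Phi(w)\|_{\mathcal{H}}^2,\qquad L_{\mathrm{KuLSIF}}(w)=\frac12\int w^2\,dP-\int w\,dQ.$$ Then $\Phi(w)$ is the Gâteaux derivative $DL_{\mathrm{KuLSIF}}(w)$ of $L_{\mathrm{KuLSIF}}$ over $\mathcal{H}$ at every $w\in\mathcal{H}$, $\Phi(w_0)=0$, and $$L_{\mathrm{KMM}}(w)=\frac12\|DL_{\mathrm{KuLSIF}}(w)\|_{\mathcal{H}}^2\qquad\text{for all }w\in\mathcal{H}.$$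
   Context: A continuous kernel $k$ on a compact metric space $\mathcal{Z}$ is universal if its RKHS $\mathcal{H}$ is dense, in the supremum norm, in the continuous functions on $\mathcal{Z}$; then $\mathcal{H}$ is called a universal RKHS. The integrals defining $\Phi(w)$ are $\mathcal{H}$-valued integrals. The Gâteaux derivative of $L:\mathcal{H}\to\mathbb{R}$ at $w$ is the element $DL(w)\in\mathcal{H}$ with $\frac{d}{dt}L(w+tv)\big|_{t=0}=\langle DL(w),v\rangle_{\mathcal{H}}$ for all $v\in\mathcal{H}$. The densities $p,q$ are with respect to a common reference measure. *)

theory Defs
  imports "HOL-Probability.Probability"
begin

text \<open>
  A Hilbert space of real functions on \<open>Z\<close> is modelled by a Hilbert space type \<open>'h\<close> together with
  the map \<open>val\<close> that sends an element \<open>f\<close> of the space to the function \<open>val f\<close> that it is.  Only the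
  values of \<open>val f\<close> on \<open>Z\<close> matter.
\<close>

definition hilbert_function_space ::
    "'z set \<Rightarrow> ('h::{real_inner, banach} \<Rightarrow> 'z \<Rightarrow> real) \<Rightarrow> bool" where
  "hilbert_function_space Z val \<longleftrightarrow>
     (\<forall>z\<in>Z. linear (\<lambda>f. val f z)) \<and>
     (\<forall>f g. (\<forall>z\<in>Z. val f z = val g z) \<longrightarrow> f = g)"

definition represents :: "'z set \<Rightarrow> ('h \<Rightarrow> 'z \<Rightarrow> real) \<Rightarrow> 'h \<Rightarrow> ('z \<Rightarrow> real) \<Rightarrow> bool" where
  "represents Z val f u \<longleftrightarrow> (\<forall>z\<in>Z. val f z = u z)"

text \<open>The element of the space that is the function \<open>u\<close>; meaningful only if there is one.\<close>

definition elem_of :: "'z set \<Rightarrow> ('h \<Rightarrow> 'z \<Rightarrow> real) \<Rightarrow> ('z \<Rightarrow> real) \<Rightarrow> 'h" where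
  "elem_of Z val u = (THE f. represents Z val f u)"

definition rkhs ::
    "'z set \<Rightarrow> ('z \<Rightarrow> 'z \<Rightarrow> real) \<Rightarrow> ('h::{real_inner, banach} \<Rightarrow> 'z \<Rightarrow> real) \<Rightarrow> bool" where
  "rkhs Z k val \<longleftrightarrow>
     hilbert_function_space Z val \<and>
     (\<forall>x\<in>Z. \<exists>kx. represents Z val kx (\<lambda>z. k z x) \<and> (\<forall>f. val f x = inner f kx))"

definition universal_rkhs ::
    "'z::metric_space set \<Rightarrow> ('z \<Rightarrow> 'z \<Rightarrow> real) \<Rightarrow> ('h::{real_inner, banach} \<Rightarrow> 'z \<Rightarrow> real) \<Rightarrow> bool"
  where
  "universal_rkhs Z k val \<longleftrightarrow>
     rkhs Z k val \<and>
     continuous_on (Z \<times> Z) (\<lambda>(x, y). k x y) \<and>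
     (\<forall>g. continuous_on Z g \<longrightarrow> (\<forall>e>0. \<exists>f. \<forall>z\<in>Z. \<bar>val f z - g z\<bar> < e))"

definition kernel_section ::
    "'z set \<Rightarrow> ('z \<Rightarrow> 'z \<Rightarrow> real) \<Rightarrow> ('h \<Rightarrow> 'z \<Rightarrow> real) \<Rightarrow> 'z \<Rightarrow> 'h" where
  "kernel_section Z k val x = elem_of Z val (\<lambda>z. k z x)"

text \<open>
  The \<open>'h\<close>-valued integrals are Bochner integrals.  The library defines these for second countable
  spaces only; an RKHS with a continuous kernel on a compact metric space is separable, hence
  second countable, so the sort constraint excludes none of them.
\<close>

definition Phi ::
    "'z set \<Rightarrow> ('z \<Rightarrow> 'z \<Rightarrow> real) \<Rightarrow>
     ('h::{real_inner, banach, second_countable_topology} \<Rightarrow> 'z \<Rightarrow> real) \<Rightarrow>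
     'z measure \<Rightarrow> 'z measure \<Rightarrow> 'h \<Rightarrow> 'h" where
  "Phi Z k val P Q w =
     (\<integral>x. val w x *\<^sub>R kernel_section Z k val x \<partial>P) - (\<integral>y. kernel_section Z k val y \<partial>Q)"

definition L_KMM ::
    "'z set \<Rightarrow> ('z \<Rightarrow> 'z \<Rightarrow> real) \<Rightarrow>
     ('h::{real_inner, banach, second_countable_topology} \<Rightarrow> 'z \<Rightarrow> real) \<Rightarrow>
     'z measure \<Rightarrow> 'z measure \<Rightarrow> 'h \<Rightarrow> real" where
  "L_KMM Z k val P Q w = 1 / 2 * (norm (Phi Z k val P Q w))\<^sup>2"

definition L_KuLSIF ::
    "('h \<Rightarrow> 'z \<Rightarrow> real) \<Rightarrow> 'z measure \<Rightarrow> 'z measure \<Rightarrow> 'h \<Rightarrow> real" where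
  "L_KuLSIF val P Q w = 1 / 2 * (\<integral>x. (val w x)\<^sup>2 \<partial>P) - (\<integral>y. val w y \<partial>Q)"

definition is_gateaux_derivative ::
    "('h::{real_inner, banach} \<Rightarrow> real) \<Rightarrow> 'h \<Rightarrow> 'h \<Rightarrow> bool" where
  "is_gateaux_derivative L w g \<longleftrightarrow>
     (\<forall>v. ((\<lambda>t. L (w + t *\<^sub>R v)) has_real_derivative inner g v) (at 0))"

definition gateaux_derivative :: "('h::{real_inner, banach} \<Rightarrow> real) \<Rightarrow> 'h \<Rightarrow> 'h" where
  "gateaux_derivative L w = (THE g. is_gateaux_derivative L w g)"

end

theory Submission
  imports Defs
begin

text \<open>
  The feature map \<open>x \<mapsto> k(\<cdot>, x)\<close> is bounded and norm-continuous on \<open>Z\<close>, so the integrals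
  in \<open>\<Phi>(w)\<close> commute with inner products, and the reproducing property yields
  \<open>\<langle>\<Phi>(w), v\<rangle> = \<integral> w v dP - \<integral> v dQ\<close>.  This is the linear coefficient of the quadratic
  polynomial \<open>t \<mapsto> L(w + t v)\<close>.
\<close>

lemma represents_unique:
  assumes "hilbert_function_space Z val" "represents Z val f u" "represents Z val g u"
  shows "f = g"
  using assms unfolding hilbert_function_space_def represents_def by metis

lemma elem_of_eq:
  assumes "hilbert_function_space Z val" "represents Z val f u"
  shows "elem_of Z val u = f"
  unfolding elem_of_def using assms by (blast intro: the_equality represents_unique)

text \<open>\<open>rkhs\<close> only asserts that some element with both properties exists. That
  element represents \<open>\<lambda>z. k z x\<close>, so by uniqueness it is the one that
  \<open>kernel_section\<close> describes, and both equations transfer to it.\<close>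

lemma rkhs_kernel_section:
  assumes "rkhs Z k val" "x \<in> Z"
  shows rkhs_reproducing: "val f x = inner f (kernel_section Z k val x)"
    and rkhs_val_kernel_section: "z \<in> Z \<Longrightarrow> val (kernel_section Z k val x) z = k z x"
proof -
  obtain kx where kx: "represents Z val kx (\<lambda>z. k z x)" "\<And>f. val f x = inner f kx"
    using assms unfolding rkhs_def by blast
  have "kernel_section Z k val x = kx"
    unfolding kernel_section_def using assms(1) kx(1) elem_of_eq unfolding rkhs_def by blast
  then show "val f x = inner f (kernel_section Z k val x)"
    and "z \<in> Z \<Longrightarrow> val (kernel_section Z k val x) z = k z x"
    using kx by (auto simp: represents_def)
qed

lemma inner_kernel_section:
  assumes "rkhs Z k val" "x \<in> Z" "y \<in> Z"
  shows "inner (kernel_section Z k val x) (kernel_section Z k val y) = k y x"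
  using assms by (metis rkhs_reproducing rkhs_val_kernel_section)

text \<open>The squared distance between two kernel sections expands into
  \<open>k y y - 2 * k y x + k x x\<close>, so continuity of the scalar kernel gives norm continuity
  of the feature map.\<close>

lemma continuous_on_kernel_section:
  fixes val :: "'h::{real_inner, banach} \<Rightarrow> 'z::metric_space \<Rightarrow> real"
  assumes rkhs: "rkhs Z k val" and cont: "continuous_on (Z \<times> Z) (\<lambda>(x, y). k x y)"
  shows "continuous_on Z (kernel_section Z k val)"
  unfolding continuous_on_def
proof
  fix x assume x: "x \<in> Z"
  let ?K = "kernel_section Z k val"
  let ?d = "\<lambda>y. sqrt (k y y - 2 * k y x + k x x)"
  \<comment> \<open>The two mixed terms of the expansion are \<open>k x y\<close> and
    \<open>k y x\<close>; they coincide by symmetry of the inner product.\<close>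
  have dist: "dist (?K y) (?K x) = ?d y" if "y \<in> Z" for y
    using inner_kernel_section[OF rkhs] x that
    by (simp add: dist_norm norm_eq_sqrt_inner inner_diff_left inner_diff_right)
       (metis inner_commute)
  \<comment> \<open>Continuity of the kernel is pulled back along the diagonal
    \<open>y \<mapsto> (y, y)\<close> and then along the slice \<open>y \<mapsto> (y, x)\<close>;
    the \<open>case\<close> form matches the hypothesis on \<open>k\<close>.\<close>
  have "continuous_on Z (\<lambda>y. case (y, y) of (a, b) \<Rightarrow> k a b)"
    by (rule continuous_on_compose2[OF cont]) (auto intro!: continuous_intros)
  moreover have "continuous_on Z (\<lambda>y. case (y, x) of (a, b) \<Rightarrow> k a b)"
    using x by (intro continuous_on_compose2[OF cont]) (auto intro!: continuous_intros)
  ultimately have "continuous_on Z (\<lambda>y. k y y)" "continuous_on Z (\<lambda>y. k y x)"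
    by simp_all
  then have "continuous_on Z ?d"
    by (intro continuous_intros)
  then have "(?d \<longlongrightarrow> ?d x) (at x within Z)"
    using x unfolding continuous_on_def by (rule bspec)
  \<comment> \<open>The radicand of \<open>?d x\<close> cancels to zero.\<close>
  then have "(?d \<longlongrightarrow> 0) (at x within Z)"
    by simp
  then have "((\<lambda>y. dist (?K y) (?K x)) \<longlongrightarrow> 0) (at x within Z)"
    by (rule Lim_transform_eventually) (simp add: dist eventually_at_filter)
  then show "(?K \<longlongrightarrow> ?K x) (at x within Z)"
    by (rule tendsto_dist_iff[THEN iffD2])
qed

text \<open>By the reproducing property \<open>val w\<close> agrees on \<open>Z\<close> with the
  inner product of \<open>w\<close> and the continuous feature map.\<close>

lemma continuous_on_rkhs_val:
  fixes val :: "'h::{real_inner, banach} \<Rightarrow> 'z::metric_space \<Rightarrow> real"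
  assumes rkhs: "rkhs Z k val" and cont: "continuous_on (Z \<times> Z) (\<lambda>(x, y). k x y)"
  shows "continuous_on Z (val w)"
proof -
  have "continuous_on Z (\<lambda>x. inner w (kernel_section Z k val x))"
    by (intro continuous_intros continuous_on_kernel_section assms)
  then show ?thesis
    using rkhs_reproducing[OF rkhs] by (simp cong: continuous_on_cong)
qed

text \<open>A continuous function on a compact set is bounded, and a bounded measurable function is
  integrable for a finite measure. The general codomain covers both the real integrands and the
  Hilbert space valued ones in \<open>Phi\<close>.\<close>

lemma integrable_continuous_on_compact:
  fixes f :: "'a::metric_space \<Rightarrow> 'b::{banach, second_countable_topology}"
  assumes "finite_measure M" "compact Z" "sets M = sets (restrict_space borel Z)" "continuous_on Z f"
  shows "integrable M f"
proof -
  have space: "space M = Z"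
    using sets_eq_imp_space_eq[OF assms(3)] by (simp add: space_restrict_space)
  have "f \<in> borel_measurable (restrict_space borel Z)"
    by (rule borel_measurable_continuous_on_restrict) fact
  then have meas: "f \<in> borel_measurable M"
    using measurable_cong_sets[OF assms(3) refl] by blast
  have "bounded (f ` Z)"
    using assms by (intro compact_imp_bounded compact_continuous_image)
  then obtain B where "\<And>x. x \<in> Z \<Longrightarrow> norm (f x) \<le> B"
    by (auto simp: bounded_iff)
  then show ?thesis
    using meas space by (intro finite_measure.integrable_const_bound[OF assms(1), where B = B]) auto
qed

lemma inner_Phi:
  fixes val :: "'h::{real_inner, banach, second_countable_topology} \<Rightarrow> 'z::metric_space \<Rightarrow> real"
  assumes compact: "compact Z" and rkhs: "rkhs Z k val"
    and cont: "continuous_on (Z \<times> Z) (\<lambda>(x, y). k x y)"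
    and P: "finite_measure P" "sets P = sets (restrict_space borel Z)"
    and Q: "finite_measure Q" "sets Q = sets (restrict_space borel Z)"
  shows "inner (Phi Z k val P Q w) v = (\<integral>x. val w x * val v x \<partial>P) - (\<integral>y. val v y \<partial>Q)"
proof -
  let ?K = "kernel_section Z k val"
  have space: "space P = Z" "space Q = Z"
    using sets_eq_imp_space_eq[OF P(2)] sets_eq_imp_space_eq[OF Q(2)]
    by (simp_all add: space_restrict_space)
  note K = continuous_on_kernel_section[OF rkhs cont]
  \<comment> \<open>Bochner integrability is what allows the bounded linear functional
    \<open>\<lambda>h. inner h v\<close> to be moved under the integral.\<close>
  have "integrable P (\<lambda>x. val w x *\<^sub>R ?K x)"
    by (intro integrable_continuous_on_compact[OF P(1) compact P(2)]
        continuous_intros K continuous_on_rkhs_val[OF rkhs cont])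
  then have "inner (\<integral>x. val w x *\<^sub>R ?K x \<partial>P) v = (\<integral>x. inner (val w x *\<^sub>R ?K x) v \<partial>P)"
    by (rule integral_inner_left[symmetric])
  also have "\<dots> = (\<integral>x. val w x * val v x \<partial>P)"
    using rkhs_reproducing[OF rkhs, of _ v] space
    by (intro Bochner_Integration.integral_cong) (auto simp: inner_commute)
  finally have P_part: "inner (\<integral>x. val w x *\<^sub>R ?K x \<partial>P) v = (\<integral>x. val w x * val v x \<partial>P)" .
  have "integrable Q ?K"
    by (rule integrable_continuous_on_compact[OF Q(1) compact Q(2) K])
  then have "inner (\<integral>y. ?K y \<partial>Q) v = (\<integral>y. inner (?K y) v \<partial>Q)"
    by (rule integral_inner_left[symmetric])
  also have "\<dots> = (\<integral>y. val v y \<partial>Q)"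
    using rkhs_reproducing[OF rkhs, of _ v] space
    by (intro Bochner_Integration.integral_cong) (auto simp: inner_commute)
  finally show ?thesis
    by (simp add: Phi_def inner_diff_left P_part)
qed

lemma Phi_is_gateaux_derivative:
  fixes val :: "'h::{real_inner, banach, second_countable_topology} \<Rightarrow> 'z::metric_space \<Rightarrow> real"
  assumes compact: "compact Z" and rkhs: "rkhs Z k val"
    and cont: "continuous_on (Z \<times> Z) (\<lambda>(x, y). k x y)"
    and P: "finite_measure P" "sets P = sets (restrict_space borel Z)"
    and Q: "finite_measure Q" "sets Q = sets (restrict_space borel Z)"
  shows "is_gateaux_derivative (L_KuLSIF val P Q) w (Phi Z k val P Q w)"
  unfolding is_gateaux_derivative_def
proof
  fix v
  have space: "space P = Z" "space Q = Z"
    using sets_eq_imp_space_eq[OF P(2)] sets_eq_imp_space_eq[OF Q(2)]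
    by (simp_all add: space_restrict_space)
  have val: "val (w + t *\<^sub>R v) x = val w x + t * val v x" if "x \<in> Z" for x t
    using rkhs_reproducing[OF rkhs that] by (simp add: inner_add_left)
  note val_cont = continuous_on_rkhs_val[OF rkhs cont]
  have int_P: "integrable P (\<lambda>x. val f x * val g x)" for f g
    by (intro integrable_continuous_on_compact[OF P(1) compact P(2)]
        continuous_intros val_cont)
  have int_Q: "integrable Q (val f)" for f
    by (rule integrable_continuous_on_compact[OF Q(1) compact Q(2) val_cont])
  let ?I = "\<lambda>f g. \<integral>x. val f x * val g x \<partial>P" and ?J = "\<lambda>f. \<integral>y. val f y \<partial>Q"
  \<comment> \<open>Along a line the functional is exactly a quadratic polynomial in
    \<open>t\<close>, with integrals as coefficients, so no limit has to be exchanged with an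
    integral. Its derivative at 0 is the coefficient of \<open>t\<close>, namely
    \<open>?I w v - ?J v\<close>.\<close>
  have "L_KuLSIF val P Q (w + t *\<^sub>R v) =
      1 / 2 * (?I w w + 2 * t * ?I w v + t\<^sup>2 * ?I v v) - (?J w + t * ?J v)" for t
  proof -
    have "(\<integral>x. (val (w + t *\<^sub>R v) x)\<^sup>2 \<partial>P) =
        (\<integral>x. val w x * val w x + 2 * t * (val w x * val v x) + t\<^sup>2 * (val v x * val v x) \<partial>P)"
      using space val
      by (intro Bochner_Integration.integral_cong) (auto simp: power2_eq_square algebra_simps)
    also have "\<dots> = ?I w w + 2 * t * ?I w v + t\<^sup>2 * ?I v v"
      by (simp add: int_P)
    finally have square: "(\<integral>x. (val (w + t *\<^sub>R v) x)\<^sup>2 \<partial>P) =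
        ?I w w + 2 * t * ?I w v + t\<^sup>2 * ?I v v" .
    have "?J (w + t *\<^sub>R v) = (\<integral>y. val w y + t * val v y \<partial>Q)"
      using space val by (intro Bochner_Integration.integral_cong) auto
    also have "\<dots> = ?J w + t * ?J v"
      by (simp add: int_Q)
    finally show ?thesis
      by (simp add: L_KuLSIF_def square)
  qed
  moreover have "((\<lambda>t. 1 / 2 * (?I w w + 2 * t * ?I w v + t\<^sup>2 * ?I v v) - (?J w + t * ?J v))
      has_real_derivative ?I w v - ?J v) (at 0)"
    by (auto intro!: derivative_eq_intros)
  ultimately show "((\<lambda>t. L_KuLSIF val P Q (w + t *\<^sub>R v)) has_real_derivative
      inner (Phi Z k val P Q w) v) (at 0)"
    by (simp add: inner_Phi[OF assms])
qed

text \<open>Real derivatives are unique, so two candidates have the same inner product with every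
  \<open>v\<close> and hence are equal. This resolves the definite description in
  \<open>gateaux_derivative\<close>.\<close>

lemma gateaux_derivative_eq:
  assumes "is_gateaux_derivative L w g"
  shows "gateaux_derivative L w = g"
  unfolding gateaux_derivative_def
proof (rule the_equality)
  fix h assume "is_gateaux_derivative L w h"
  with assms have "inner h v = inner g v" for v
    unfolding is_gateaux_derivative_def using DERIV_unique by blast
  then show "h = g"
    by (metis vector_eq_rdot)
qed fact

text \<open>Written against the reference measure, the first integrand carries the weight
  \<open>p * (q / p) = q\<close>, the cancellation being valid since \<open>p > 0\<close> on
  \<open>Z\<close>. Both integrals in \<open>Phi\<close> thus become the integral of
  \<open>q\<close> times the kernel section over \<open>M\<close>.\<close>

lemma Phi_density_ratio_eq_0:
  fixes val :: "'h::{real_inner, banach, second_countable_topology} \<Rightarrow> 'z::metric_space \<Rightarrow> real"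
  assumes rkhs: "rkhs Z k val" and cont: "continuous_on (Z \<times> Z) (\<lambda>(x, y). k x y)"
    and M: "sets M = sets (restrict_space borel Z)"
    and p: "p \<in> borel_measurable M" "\<And>z. z \<in> Z \<Longrightarrow> p z > 0"
    and q: "q \<in> borel_measurable M" "\<And>z. z \<in> Z \<Longrightarrow> q z \<ge> 0"
    and w0: "represents Z val w0 (\<lambda>z. q z / p z)"
  shows "Phi Z k val (density M (\<lambda>z. ennreal (p z))) (density M (\<lambda>z. ennreal (q z))) w0 = 0"
proof -
  let ?K = "kernel_section Z k val"
  have space: "space M = Z"
    using sets_eq_imp_space_eq[OF M] by (simp add: space_restrict_space)
  \<comment> \<open>The codomain is left general because the fact is applied to the feature map and
    to the real function \<open>val w0\<close>.\<close>
  have meas: "f \<in> borel_measurable M" if "continuous_on Z f" for f :: "'z \<Rightarrow> 'b::topological_space"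
    using borel_measurable_continuous_on_restrict[OF that] measurable_cong_sets[OF M refl] by blast
  have K [measurable]: "?K \<in> borel_measurable M"
    by (intro meas continuous_on_kernel_section[OF rkhs cont])
  have [measurable]: "val w0 \<in> borel_measurable M"
    by (intro meas continuous_on_rkhs_val[OF rkhs cont])
  \<comment> \<open>The change to \<open>M\<close> rests on measurability and nonnegativity of the
    density alone; \<open>M\<close> may be infinite.\<close>
  have "(\<integral>x. val w0 x *\<^sub>R ?K x \<partial>density M (\<lambda>z. ennreal (p z))) =
      (\<integral>x. p x *\<^sub>R (val w0 x *\<^sub>R ?K x) \<partial>M)"
    using p space by (intro integral_density) (auto intro!: AE_I2 less_imp_le)
  also have "\<dots> = (\<integral>x. q x *\<^sub>R ?K x \<partial>M)"
  proof (rule Bochner_Integration.integral_cong[OF refl])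
    fix x assume "x \<in> space M"
    then have "val w0 x = q x / p x" "p x \<noteq> 0"
      using w0 p(2)[of x] space by (auto simp: represents_def)
    then show "p x *\<^sub>R (val w0 x *\<^sub>R ?K x) = q x *\<^sub>R ?K x"
      by simp
  qed
  also have "\<dots> = (\<integral>y. ?K y \<partial>density M (\<lambda>z. ennreal (q z)))"
    using q space by (intro integral_density[symmetric]) (auto intro!: AE_I2)
  finally show ?thesis
    by (simp add: Phi_def)
qed

theorem mainTheorem5:
  fixes Z :: "'z::metric_space set"
    and k :: "'z \<Rightarrow> 'z \<Rightarrow> real"
    and val :: "'h::{real_inner, banach, second_countable_topology} \<Rightarrow> 'z \<Rightarrow> real"
    and M P Q :: "'z measure"
    and p q :: "'z \<Rightarrow> real"
  assumes compact: "compact Z"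
    and universal: "universal_rkhs Z k val"
    and reference_measure: "sets M = sets (restrict_space borel Z)"
    and p_measurable: "p \<in> borel_measurable M"
    and q_measurable: "q \<in> borel_measurable M"
    and p_pos: "\<And>z. z \<in> Z \<Longrightarrow> p z > 0"
    and q_nonneg: "\<And>z. z \<in> Z \<Longrightarrow> q z \<ge> 0"
    and P_density: "P = density M (\<lambda>z. ennreal (p z))"
    and Q_density: "Q = density M (\<lambda>z. ennreal (q z))"
    and P_prob: "prob_space P"
    and Q_prob: "prob_space Q"
    and w0_in_H: "\<exists>w0. represents Z val w0 (\<lambda>z. q z / p z)"
  shows "(\<forall>w. is_gateaux_derivative (L_KuLSIF val P Q) w (Phi Z k val P Q w)) \<and>
         Phi Z k val P Q (elem_of Z val (\<lambda>z. q z / p z)) = 0 \<and>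
         (\<forall>w. L_KMM Z k val P Q w =
                1 / 2 * (norm (gateaux_derivative (L_KuLSIF val P Q) w))\<^sup>2)"
proof -
  have rkhs: "rkhs Z k val" and cont: "continuous_on (Z \<times> Z) (\<lambda>(x, y). k x y)"
    using universal by (auto simp: universal_rkhs_def)
  have sets: "sets P = sets (restrict_space borel Z)" "sets Q = sets (restrict_space borel Z)"
    by (simp_all add: P_density Q_density reference_measure)
  have finite: "finite_measure P" "finite_measure Q"
    using P_prob Q_prob by (simp_all add: prob_space.finite_measure)
  have deriv: "is_gateaux_derivative (L_KuLSIF val P Q) w (Phi Z k val P Q w)" for w
    using compact rkhs cont finite(1) sets(1) finite(2) sets(2) by (rule Phi_is_gateaux_derivative)
  obtain w0 where w0: "represents Z val w0 (\<lambda>z. q z / p z)"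
    using w0_in_H by blast
  have "elem_of Z val (\<lambda>z. q z / p z) = w0"
    using rkhs w0 by (intro elem_of_eq) (simp_all add: rkhs_def)
  moreover have "Phi Z k val P Q w0 = 0"
    unfolding P_density Q_density
    using rkhs cont reference_measure p_measurable p_pos q_measurable q_nonneg w0
    by (rule Phi_density_ratio_eq_0)
  ultimately show ?thesis
    \<comment> \<open>The norm identity is the definition of \<open>L_KMM\<close> once the
      derivative has been identified with \<open>Phi\<close>.\<close>
    using deriv by (simp add: gateaux_derivative_eq[OF deriv] L_KMM_def)
qed

end
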